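(* Let $p$ be a prime number and $\mathbb{K}$ a field of characteristic $p$. Let $q>p$ be an integer not divisible by $p$, and denote by $\ell$ the smallest nonnegative integer such that $q=\ell$ in $\mathbb{K}$. Then for every power series $f\in\mathbb{K}[[z]]$ with $f(0)=0$ and $\operatorname{mult}(f)=q+1$, and every integer $n\geq 1$, one has $$i_n(f)=\ell(1+p+\dots+p^{n-1})+qp^n$$ if and only if $\iota_1(f)\neq 0$.
   Context: For a power series $f\in\mathbb{K}[[z]]$ with $f(0)=0$, the multiplicity $\operatorname{mult}(f)$ is the integer $m$ with $f(z)-z=a_mz^m+\cdots$, $a_m\neq0$ (and $\operatorname{mult}(z)=\infty$). The lower ramification numbers of $f$ (with $f(0)=0$, $f'(0)=1$) are $i_n(f)=\operatorname{mult}(f^{p^n})-1$ for $n\ge0$, where $f^{p^n}$ is the $p^n$-th iterate under composition. The second residue fixed point index $\iota_1(f)$ is the coefficient of $\frac1z$ in the Laurent series expansion about $0$ of $\dfrac{z^{q-\ell}}{z-f(z)}$. *)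

theory Defs
  imports
    "HOL-Computational_Algebra.Primes"
    "HOL-Computational_Algebra.Formal_Laurent_Series"
    "HOL-Library.Extended_Nat"
begin

definition fps_iterate :: "nat \<Rightarrow> 'a::comm_ring_1 fps \<Rightarrow> 'a fps" where
  "fps_iterate k f = ((\<lambda>g. f oo g) ^^ k) fps_X"

(* Multiplicity of 0 as a fixed point of f (not the order of vanishing of f itself);
   only meaningful for f(0) = 0. *)
definition fps_mult :: "'a::comm_ring_1 fps \<Rightarrow> enat" where
  "fps_mult f = (if f = fps_X then \<infinity> else enat (subdegree (f - fps_X)))"

(* The library has \<infinity> - 1 = \<infinity>, so the value is \<infinity> exactly when
   the p^n-th iterate is the identity. *)
definition lower_ramification_number :: "nat \<Rightarrow> nat \<Rightarrow> 'a::comm_ring_1 fps \<Rightarrow> enat" where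
  "lower_ramification_number p n f = fps_mult (fps_iterate (p ^ n) f) - 1"

(* Here l is meant to be the least natural number whose image in the field is that of q;
   then l \<le> q, so the natural subtraction q - l is exact. *)
definition second_residue_index :: "nat \<Rightarrow> nat \<Rightarrow> 'a::field fps \<Rightarrow> 'a" where
  "second_residue_index q l f =
     fls_nth (fls_X ^ (q - l) / (fls_X - fps_to_fls f)) (-1)"

end

theory Submission
  imports Defs
begin

text \<open>
  Write \<open>f = X + X\<^sup>q\<^sup>+\<^sup>1 u\<close> with \<open>u(0) \<noteq> 0\<close>. Then the second residue index is
  minus the coefficient of \<open>X\<^sup>l\<close> in \<open>1/u\<close> (\<open>second_residue_index_eq\<close>), so everything
  depends on whether that coefficient vanishes.

  The tool is the difference operator \<open>\<Delta>g = g \<circ> f - g\<close>. It raises orders of vanishing by at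
  least \<open>q\<close>, and in characteristic \<open>p\<close> its \<open>p\<close>-th power is the difference operator of the iterate
  \<open>f\<^sup>p\<close>, because the inner binomial coefficients in \<open>(1 + \<Delta>)\<^sup>p\<close> vanish. Applied to
  \<open>X\<close> this gives the crude bound that \<open>f\<^sup>p - X\<close> has order at least \<open>qp + 1\<close>. To
  find the order exactly, apply \<open>\<Delta>\<^sup>p\<close> instead to an approximate Fatou coordinate: a series
  \<open>\<psi>\<close> with \<open>(f - X) \<psi>'\<close> as close as possible to a \<open>p\<close>-th power. One would like to
  integrate \<open>1/(f - X)\<close>, and the term with exponent \<open>l - q - 1\<close>, whose coefficient is the
  residue index up to sign, is the first one that has no antiderivative. So
  \<open>\<Delta>\<psi>\<close> is the monomial \<open>X\<^sup>q\<^sup>p\<close>, which \<open>\<Delta>\<close> nearly annihilates, plus an error led by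
  this coefficient. Following the error through the other \<open>p - 1\<close> applications of \<open>\<Delta>\<close> shows
  that \<open>f\<^sup>p - X\<close> has order at least \<open>qp + l + 1\<close>, with equality exactly if the index
  is nonzero (\<open>fps_iterate_CHAR_leading\<close>).

  The same statement can be applied to \<open>f\<^sup>p\<close>, with \<open>qp + l\<close> in place of \<open>q\<close>, once the index
  of \<open>f\<^sup>p\<close> is known to be nonzero as well. This follows from \<open>f\<close> and \<open>f\<^sup>p\<close> commuting:
  to first order, commuting means that the Wronskian of \<open>f - X\<close> and \<open>f\<^sup>p - X\<close> vanishes, so
  that their quotient is constant up to a power of \<open>X\<close> and terms of relative order above \<open>l\<close>
  (\<open>commuting_fps_inverse_nth\<close>). The inequality \<open>q > l\<close>, a consequence of \<open>q > p\<close>, is what makes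
  all the second-order errors, of relative order \<open>q\<close>, negligible. By induction the asserted
  value of \<open>i\<^sub>n\<close> is attained whenever the index is nonzero.

  If the index vanishes, then \<open>i\<^sub>1 \<ge> qp + l + 1\<close>, and the crude bound \<open>i\<^sub>n\<^sub>+\<^sub>1 \<ge> p i\<^sub>n\<close>
  already pushes every \<open>i\<^sub>n\<close> above the asserted value.
\<close>

section \<open>Orders of vanishing\<close>

lemma fps_X_power_dvd_iff:
  fixes g :: "'a::field fps"
  shows "fps_X ^ m dvd g \<longleftrightarrow> (\<forall>i<m. g $ i = 0)"
proof
  assume "fps_X ^ m dvd g"
  then show "\<forall>i<m. g $ i = 0"
    by (auto simp: dvd_def fps_X_power_mult_nth)
next
  assume *: "\<forall>i<m. g $ i = 0"
  have "g = fps_X ^ m * fps_shift m g"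
    using * by (auto simp: fps_eq_iff fps_X_power_mult_nth)
  then show "fps_X ^ m dvd g"
    by (metis dvd_triv_left)
qed

lemma fps_X_power_dvd_mono:
  fixes g :: "'a::field fps"
  shows "fps_X ^ m dvd g \<Longrightarrow> k \<le> m \<Longrightarrow> fps_X ^ k dvd g"
  by (rule dvd_trans[OF le_imp_power_dvd])

lemma fps_X_power_dvd_deriv:
  fixes g :: "'a::field fps"
  assumes "fps_X ^ m dvd g"
  shows "fps_X ^ (m - 1) dvd fps_deriv g"
  using assms by (auto simp: fps_X_power_dvd_iff)

lemma fps_X_power_dvd_compose:
  fixes g f :: "'a::field fps"
  assumes "fps_X ^ m dvd g" "f $ 0 = 0"
  shows "fps_X ^ m dvd g oo f"
proof -
  obtain r where r: "g = fps_X ^ m * r" using assms(1) by (auto simp: dvd_def)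
  have "g oo f = f ^ m * (r oo f)"
    unfolding r using assms(2) by (simp add: fps_compose_mult_distrib fps_X_power_compose)
  moreover have "fps_X ^ m dvd f ^ m"
    using assms(2) fps_X_power_dvd_iff[of 1 f] by (intro dvd_power_same) simp
  ultimately show ?thesis by simp
qed

lemma fps_compose_cmult_left:
  fixes g f :: "'a::field fps"
  assumes "f $ 0 = 0"
  shows "(fps_const c * g) oo f = fps_const c * (g oo f)"
  using assms by (simp add: fps_compose_mult_distrib)

section \<open>First-order Taylor expansion\<close>

lemma square_dvd_binomial_remainder:
  fixes y :: "'a::comm_ring_1"
  shows "y ^ 2 dvd (1 + y) ^ k - 1 - of_nat k * y"
proof (induction k)
  case (Suc k)
  have "(1 + y) ^ Suc k - 1 - of_nat (Suc k) * y
      = (1 + y) * ((1 + y) ^ k - 1 - of_nat k * y) + of_nat k * y ^ 2"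
    by (simp add: algebra_simps power2_eq_square)
  then show ?case using Suc by simp
qed simp

text \<open>
  Multiplying by \<open>X\<close> removes the case distinction on a zero exponent from the power rule.
\<close>
lemma fps_X_mult_deriv_X_power:
  "fps_X * fps_deriv (fps_X ^ k) = (of_nat k * fps_X ^ k :: 'a::field fps)"
  by (rule fps_ext) (simp add: fps_of_nat[symmetric])

lemma Taylor_remainder_monomial:
  fixes h :: "'a::field fps"
  assumes "fps_X ^ Suc s dvd h"
  shows "fps_X ^ (k + 2 * s) dvd (fps_X + h) ^ k - fps_X ^ k - h * fps_deriv (fps_X ^ k)"
proof -
  obtain t where t: "h = fps_X ^ Suc s * t" using assms by (auto simp: dvd_def)
  define y where "y = fps_X ^ s * t"
  have h: "h = fps_X * y" by (simp add: t y_def mult.assoc)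
  have "(fps_X + h) ^ k = fps_X ^ k * (1 + y) ^ k"
    unfolding h power_mult_distrib[symmetric] by (simp add: distrib_left)
  moreover have "h * fps_deriv (fps_X ^ k) = fps_X ^ k * (of_nat k * y)"
    unfolding h using fps_X_mult_deriv_X_power[of k, where ?'a = 'a]
    by (simp add: mult.left_commute mult.assoc)
  ultimately have "(fps_X + h) ^ k - fps_X ^ k - h * fps_deriv (fps_X ^ k)
      = fps_X ^ k * ((1 + y) ^ k - 1 - of_nat k * y)"
    by (simp add: algebra_simps)
  moreover have "y ^ 2 = fps_X ^ (2 * s) * t ^ 2"
    unfolding y_def by (simp only: power_mult_distrib power_mult[symmetric] mult.commute[of s 2])
  then have "fps_X ^ (2 * s) dvd (1 + y) ^ k - 1 - of_nat k * y"
    using square_dvd_binomial_remainder[of y k] by (metis dvd_mult_left)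
  ultimately show ?thesis by (simp add: power_add mult_dvd_mono)
qed

text \<open>
  With \<open>h\<close> of order above \<open>s\<close>, each further term \<open>h\<^sup>j g\<^sup>(\<^sup>j\<^sup>)/j!\<close> of the Taylor expansion
  raises the order by another \<open>s\<close>. The divided derivatives exist in every characteristic, but it
  is simpler to check monomials with the binomial expansion and to extend to series by
  splitting off leading terms.
\<close>
lemma Taylor_remainder:
  fixes h g :: "'a::field fps"
  assumes h: "fps_X ^ Suc s dvd h" and g: "fps_X ^ m dvd g"
  shows "fps_X ^ (m + 2 * s) dvd (g oo (fps_X + h)) - g - h * fps_deriv g"
proof -
  define R where "R g = (g oo (fps_X + h)) - g - h * fps_deriv g" for g
  have h0: "h $ 0 = 0" using h by (auto simp: fps_X_power_dvd_iff)
  have R_monom: "fps_X ^ (k + 2 * s) dvd R (fps_const c * fps_X ^ k)" for c k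
  proof -
    have "R (fps_const c * fps_X ^ k)
        = fps_const c * ((fps_X + h) ^ k - fps_X ^ k - h * fps_deriv (fps_X ^ k))"
      using h0 unfolding R_def
      by (simp add: fps_compose_cmult_left fps_X_power_compose algebra_simps)
    then show ?thesis using Taylor_remainder_monomial[OF h] by simp
  qed
  (* Splitting off one monomial at a time gains one order of precision per step. *)
  have "fps_X ^ min (m + d) (m + 2 * s) dvd R g" if "fps_X ^ m dvd g" for d m g
    using that
  proof (induction d arbitrary: m g)
    case 0
    have "fps_X ^ m dvd g oo (fps_X + h)"
      using 0 h0 by (intro fps_X_power_dvd_compose) auto
    moreover have "fps_X ^ (Suc s + (m - 1)) dvd h * fps_deriv g"
      unfolding power_add by (rule mult_dvd_mono[OF h fps_X_power_dvd_deriv[OF 0]])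
    then have "fps_X ^ m dvd h * fps_deriv g"
      by (rule fps_X_power_dvd_mono) simp
    ultimately show ?case using 0 by (simp add: R_def)
  next
    case (Suc d)
    define g' where "g' = g - fps_const (g $ m) * fps_X ^ m"
    have "fps_X ^ Suc m dvd g'"
      using Suc.prems by (auto simp: g'_def fps_X_power_dvd_iff less_Suc_eq simp del: power_Suc)
    then have "fps_X ^ min (Suc m + d) (Suc m + 2 * s) dvd R g'" by (rule Suc.IH)
    then have "fps_X ^ min (m + Suc d) (m + 2 * s) dvd R g'"
      by (rule fps_X_power_dvd_mono) simp
    moreover have "fps_X ^ min (m + Suc d) (m + 2 * s) dvd R (fps_const (g $ m) * fps_X ^ m)"
      by (rule fps_X_power_dvd_mono[OF R_monom]) simp
    moreover have "R g = R g' + R (fps_const (g $ m) * fps_X ^ m)"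
      unfolding R_def g'_def
      by (simp add: fps_compose_sub_distrib algebra_simps)
    ultimately show ?case by simp
  qed
  from this[OF g, of "2 * s"] show ?thesis by (simp add: R_def)
qed

section \<open>The difference operator of a power series\<close>

definition fps_diff_op :: "'a::field fps \<Rightarrow> 'a fps \<Rightarrow> 'a fps" where
  "fps_diff_op f g = (g oo f) - g"

lemma fps_diff_op_add: "fps_diff_op f (a + b) = fps_diff_op f a + fps_diff_op f b"
  by (simp add: fps_diff_op_def fps_compose_add_distrib)

lemma funpow_fps_diff_op_add:
  "(fps_diff_op f ^^ k) (a + b) = (fps_diff_op f ^^ k) a + (fps_diff_op f ^^ k) b"
  by (induction k) (simp_all add: fps_diff_op_add)

lemma fps_iterate_Suc: "fps_iterate (Suc k) f = f oo fps_iterate k f"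
  by (simp add: fps_iterate_def)

lemma fps_iterate_nth_0 [simp]: "f $ 0 = 0 \<Longrightarrow> fps_iterate k f $ 0 = 0"
  by (cases k) (simp_all add: fps_iterate_def)

lemma fps_iterate_add:
  fixes f :: "'a::field fps"
  assumes "f $ 0 = 0"
  shows "fps_iterate (j + k) f = fps_iterate j f oo fps_iterate k f"
proof (induction j)
  case 0
  show ?case using assms by (simp add: fps_iterate_def[of 0])
next
  case (Suc j)
  then show ?case using assms by (simp add: fps_iterate_Suc fps_compose_assoc)
qed

lemma fps_iterate_mult:
  fixes f :: "'a::field fps"
  assumes "f $ 0 = 0"
  shows "fps_iterate (j * k) f = fps_iterate j (fps_iterate k f)"
proof (induction j)
  case (Suc j)
  then show ?case using assms by (simp add: fps_iterate_Suc fps_iterate_add)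
qed (simp add: fps_iterate_def)

lemma fps_iterate_1 [simp]: "fps_iterate (Suc 0) f = (f :: 'a::field fps)"
  by (simp add: fps_iterate_def)

lemma fps_iterate_commute:
  fixes f :: "'a::field fps"
  assumes "f $ 0 = 0"
  shows "f oo fps_iterate k f = fps_iterate k f oo f"
  using fps_iterate_add[OF assms, of 1 k] fps_iterate_add[OF assms, of k 1] by simp

text \<open>
  Composition with \<open>f\<close> on the right is the operator \<open>1 + \<Delta>\<close>, and this is the binomial theorem
  for its powers.
\<close>
lemma fps_compose_iterate_binomial:
  fixes f g :: "'a::field fps"
  assumes "f $ 0 = 0"
  shows "g oo fps_iterate k f = (\<Sum>i\<le>k. of_nat (k choose i) * (fps_diff_op f ^^ i) g)"
proof (induction k arbitrary: g)
  case 0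
  show ?case by (simp add: fps_iterate_def)
next
  case (Suc k)
  let ?D = "\<lambda>i. (fps_diff_op f ^^ i) g"
  have "g oo fps_iterate (Suc k) f = (g oo f) oo fps_iterate k f"
    using assms by (simp add: fps_iterate_Suc fps_compose_assoc)
  also have "g oo f = g + fps_diff_op f g"
    by (simp add: fps_diff_op_def)
  also have "(g + fps_diff_op f g) oo fps_iterate k f
      = (\<Sum>i\<le>k. of_nat (k choose i) * ?D i) + (\<Sum>i\<le>k. of_nat (k choose i) * ?D (Suc i))"
    unfolding Suc.IH
    by (simp add: funpow_fps_diff_op_add funpow_Suc_right sum.distrib algebra_simps del: funpow.simps)
  also have "(\<Sum>i\<le>k. of_nat (k choose i) * ?D i)
      = ?D 0 + (\<Sum>i\<le>k. of_nat (k choose Suc i) * ?D (Suc i))"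
    using sum.atMost_Suc_shift[of "\<lambda>i. of_nat (k choose i) * ?D i" k] by (simp add: binomial_eq_0)
  also have "?D 0 + (\<Sum>i\<le>k. of_nat (k choose Suc i) * ?D (Suc i))
        + (\<Sum>i\<le>k. of_nat (k choose i) * ?D (Suc i))
      = (\<Sum>i\<le>Suc k. of_nat (Suc k choose i) * ?D i)"
    unfolding sum.atMost_Suc_shift
    by (simp add: sum.distrib algebra_simps del: funpow.simps) 
  finally show ?case .
qed

lemma fps_diff_op_power_CHAR:
  fixes f g :: "'a::field fps"
  assumes "f $ 0 = 0" "prime p" "CHAR('a) = p"
  shows "(fps_diff_op f ^^ p) g = (g oo fps_iterate p f) - g"
proof -
  have p: "p > 0" using assms(2) by (rule prime_gt_0_nat)
  have "g oo fps_iterate p f = (\<Sum>i\<in>{0, p}. of_nat (p choose i) * (fps_diff_op f ^^ i) g)"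
    unfolding fps_compose_iterate_binomial[OF assms(1)]
  proof (rule sum.mono_neutral_right)
    show "\<forall>i\<in>{..p} - {0, p}. of_nat (p choose i) * (fps_diff_op f ^^ i) g = 0"
    proof
      fix i assume "i \<in> {..p} - {0, p}"
      then have "p dvd (p choose i)" using assms(2) by (intro dvd_choose_prime) auto
      then have "(of_nat (p choose i) :: 'a fps) = 0"
        using assms(3) by (simp add: of_nat_eq_0_iff_char_dvd)
      then show "of_nat (p choose i) * (fps_diff_op f ^^ i) g = 0" by simp
    qed
  qed auto
  also have "\<dots> = g + (fps_diff_op f ^^ p) g"
    using p by simp
  finally show ?thesis by simp
qed

text \<open>
  To first order \<open>\<Delta>\<close> is the derivation \<open>g \<mapsto> (f - X) g'\<close>; on a series of order \<open>m\<close> its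
  leading term has the factor \<open>m\<close>, so that the order rises by more than \<open>s\<close> when the characteristic
  divides \<open>m\<close>.
\<close>

lemma fps_diff_op_leading:
  fixes u g :: "'a::field fps"
  assumes f: "f = fps_X + fps_X ^ Suc s * u" and s: "s > 0" and g: "fps_X ^ m dvd g"
  shows "fps_X ^ (m + s) dvd fps_diff_op f g"
    and "fps_diff_op f g $ (m + s) = of_nat m * u $ 0 * g $ m"
proof -
  let ?h = "fps_X ^ Suc s * u"
  define E where "E = (g oo (fps_X + ?h)) - g - ?h * fps_deriv g"
  have E: "fps_X ^ (m + 2 * s) dvd E"
    unfolding E_def by (rule Taylor_remainder[OF _ g]) simp
  have D: "fps_diff_op f g = ?h * fps_deriv g + E"
    by (simp add: fps_diff_op_def E_def f)
  obtain r where r: "g = fps_X ^ m * r" using g by (auto simp: dvd_def)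
  have gm: "g $ m = r $ 0" by (simp add: r fps_X_power_mult_nth)
  have "?h * fps_deriv g
      = fps_X ^ s * u * ((fps_X * fps_deriv (fps_X ^ m)) * r + fps_X * fps_X ^ m * fps_deriv r)"
    unfolding r fps_deriv_mult by (simp add: algebra_simps)
  then have hg: "?h * fps_deriv g = fps_X ^ (m + s) * (of_nat m * u * r + fps_X * u * fps_deriv r)"
    unfolding fps_X_mult_deriv_X_power by (simp add: power_add algebra_simps)
  show "fps_X ^ (m + s) dvd fps_diff_op f g"
    unfolding D hg using E by (intro dvd_add dvd_triv_left) (rule fps_X_power_dvd_mono, auto)
  have "E $ (m + s) = 0"
    using E s by (simp add: fps_X_power_dvd_iff)
  then show "fps_diff_op f g $ (m + s) = of_nat m * u $ 0 * g $ m"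
    unfolding D hg fps_add_nth
    by (simp add: fps_X_power_mult_nth gm fps_of_nat[symmetric] mult.assoc)
qed

lemma funpow_fps_diff_op_leading:
  fixes u g :: "'a::field fps"
  assumes f: "f = fps_X + fps_X ^ Suc s * u" and s: "s > 0" and g: "fps_X ^ m dvd g"
  shows "fps_X ^ (m + j * s) dvd (fps_diff_op f ^^ j) g
       \<and> (fps_diff_op f ^^ j) g $ (m + j * s) = (\<Prod>i<j. of_nat (m + i * s)) * (u $ 0) ^ j * g $ m"
proof (induction j)
  case (Suc j)
  then show ?case
    using fps_diff_op_leading[OF f s, of "m + j * s" "(fps_diff_op f ^^ j) g"]
    by (simp add: ac_simps)
qed (use g in simp)


text \<open>
  Here \<open>\<Delta>\<^sup>p X = g\<^sup>p - X\<close>, and each of the \<open>p\<close> applications contributes \<open>s\<close> to the order. The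
  bound is not sharp, but it suffices both as an a priori estimate and for series of index zero.
\<close>
lemma fps_iterate_CHAR_order:
  fixes g :: "'a::field fps"
  assumes "prime p" "CHAR('a) = p" "s > 0" and g: "fps_X ^ Suc s dvd g - fps_X"
  shows "fps_X ^ Suc (s * p) dvd fps_iterate p g - fps_X"
proof -
  obtain u where u: "g - fps_X = fps_X ^ Suc s * u" using g by (auto simp: dvd_def)
  then have gu: "g = fps_X + fps_X ^ Suc s * u" by (metis add.commute diff_add_cancel)
  then have g0: "g $ 0 = 0" by simp
  have "fps_X ^ (1 + p * s) dvd (fps_diff_op g ^^ p) fps_X"
    using funpow_fps_diff_op_leading[OF gu \<open>s > 0\<close>, of 1 fps_X p] by simp
  also have "(fps_diff_op g ^^ p) fps_X = fps_iterate p g - fps_X"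
    using g0 by (subst fps_diff_op_power_CHAR[OF g0 assms(1,2)]) simp
  finally show ?thesis by (simp add: mult.commute)
qed

section \<open>The first iterate\<close>

text \<open>
  The series \<open>\<psi>\<close> in the proof is an antiderivative of the first \<open>l\<close> terms of
  \<open>X\<^sup>q\<^sup>p/(f - X)\<close>; the factor \<open>X\<^sup>q\<^sup>p\<close> has derivative zero and serves only to avoid
  negative exponents. The difference \<open>\<Delta>\<^sup>p \<psi> = \<psi> \<circ> f\<^sup>p - \<psi>\<close> is computed in two ways.
  Applying \<open>\<Delta>\<close> repeatedly exhibits its coefficient at order \<open>N\<close> as a nonzero multiple of
  the residue coefficient. To first order it is also \<open>(f\<^sup>p - X) \<psi>'\<close>, which gives \<open>f\<^sup>p - X\<close>
  because \<open>\<psi>'\<close> is a power of \<open>X\<close> times a unit.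
\<close>
lemma fps_iterate_CHAR_leading:
  fixes u :: "'a::field fps"
  assumes p: "prime p" "CHAR('a) = p"
    and l: "0 < l" "l < p" "l < q" and ql: "of_nat q = (of_nat l :: 'a)"
    and f: "f = fps_X + fps_X ^ Suc q * u" and u0: "u $ 0 \<noteq> 0"
  shows "\<exists>v. fps_iterate p f = fps_X + fps_X ^ Suc (q * p + l) * v
            \<and> (v $ 0 = 0 \<longleftrightarrow> inverse u $ l = 0)"
proof -
  have p2: "p \<ge> 2" using p(1) by (rule prime_ge_2_nat)
  have p0: "of_nat p = (0::'a)" using p(2) by (metis of_nat_CHAR)
  have f0: "f $ 0 = 0" by (simp add: f)
  define w where "w = inverse u"
  have uw: "u * w = 1" using u0 by (simp add: w_def inverse_mult_eq_1')
  have w0: "w $ 0 \<noteq> 0" using u0 by (simp add: w_def)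
  define m where "m = q * (p - 1)"
  have mq: "m + q = q * p" using p2 by (cases p) (simp_all add: m_def)
  have m0: "m > 0" using p2 l by (simp add: m_def)
  define h where "h = fps_X ^ Suc q * u"
  have fh: "f = fps_X + h" by (simp add: f h_def)
  have h_dvd: "fps_X ^ Suc q dvd h" by (simp add: h_def)

  (* In the field, m + k equals k - l, so all exponents of \<psi> below m + l are invertible and
     the integration breaks down exactly at k = l. *)
  have nz: "of_nat (m + k) \<noteq> (0::'a)" if "k < l" for k
  proof
    assume "of_nat (m + k) = (0::'a)"
    then have "of_nat (m + q + k) = (of_nat q :: 'a)"
      by (simp add: add_ac)
    then have "of_nat (q * p + k) = (of_nat l :: 'a)" unfolding mq ql .
    then have "(of_nat (l - k) :: 'a) = 0" using that by (simp add: p0 of_nat_diff)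
    then have "p dvd l - k" using p(2) by (simp add: of_nat_eq_0_iff_char_dvd)
    then show False using that l by (auto dest: dvd_imp_le)
  qed
  define \<psi> where "\<psi> = Abs_fps (\<lambda>n. if m \<le> n \<and> n < m + l then w $ (n - m) / of_nat n else 0)"
  define y where "y = fps_cutoff l w"
  have y0: "y $ 0 = w $ 0" using l by (simp add: y_def)
  have deriv_\<psi>: "fps_deriv \<psi> = fps_X ^ (m - 1) * y"
  proof (rule fps_ext)
    fix n
    show "fps_deriv \<psi> $ n = (fps_X ^ (m - 1) * y) $ n"
    proof (cases "m \<le> Suc n \<and> Suc n < m + l")
      case True
      then obtain k where k: "Suc n = m + k" "k < l" by (metis le_Suc_ex nat_add_left_cancel_less)
      then have "n = (m - 1) + k" using m0 by simp
      moreover have "of_nat (Suc n) \<noteq> (0::'a)" unfolding k(1) by (rule nz[OF k(2)])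
      ultimately show ?thesis using k
        by (simp add: \<psi>_def y_def fps_X_power_mult_nth del: of_nat_Suc of_nat_add)
    next
      case False
      then show ?thesis using m0
        by (auto simp: \<psi>_def y_def fps_X_power_mult_nth simp del: of_nat_Suc)
    qed
  qed
  have \<psi>_dvd: "fps_X ^ m dvd \<psi>" by (simp add: fps_X_power_dvd_iff \<psi>_def)

  define t where "t = u * fps_shift l w"
  have t0: "t $ 0 = u $ 0 * w $ l" by (simp add: t_def)
  have "w = fps_X ^ l * fps_shift l w + y"
    using fps_shift_cutoff[of l w] by (simp add: y_def mult.commute)
  then have "u * w = fps_X ^ l * t + u * y"
    by (metis distrib_left mult.left_commute t_def)
  then have uy: "u * y = 1 - fps_X ^ l * t" using uw by (simp add: algebra_simps)
  have "h * fps_deriv \<psi> = fps_X ^ (Suc q + (m - 1)) * (u * y)"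
    unfolding deriv_\<psi> h_def power_add by (simp only: ac_simps)
  also have "Suc q + (m - 1) = q * p" using mq m0 by simp
  finally have h_deriv: "h * fps_deriv \<psi> = fps_X ^ (q * p) - fps_X ^ (q * p + l) * t"
    unfolding uy by (simp add: algebra_simps power_add)

  define N where "N = q * p + l + (p - 1) * q"
  define r where "r = fps_diff_op f \<psi> - fps_X ^ (q * p)"
  have r_eq: "r = ((\<psi> oo (fps_X + h)) - \<psi> - h * fps_deriv \<psi>) - fps_X ^ (q * p + l) * t"
    unfolding h_deriv r_def fps_diff_op_def fh by simp
  have "fps_X ^ (m + 2 * q) dvd (\<psi> oo (fps_X + h)) - \<psi> - h * fps_deriv \<psi>"
    by (rule Taylor_remainder[OF h_dvd \<psi>_dvd])
  then have E: "fps_X ^ Suc (q * p + l) dvd (\<psi> oo (fps_X + h)) - \<psi> - h * fps_deriv \<psi>"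
    by (rule fps_X_power_dvd_mono) (use l mq in linarith)
  (* The Taylor error has order at least qp + q; as q > l, the leading term of r is that of t. *)
  have r_dvd: "fps_X ^ (q * p + l) dvd r"
    unfolding r_eq by (rule dvd_diff[OF fps_X_power_dvd_mono[OF E]]) simp_all
  have "((\<psi> oo (fps_X + h)) - \<psi> - h * fps_deriv \<psi>) $ (q * p + l) = 0"
    using E unfolding fps_X_power_dvd_iff by blast
  then have r_nth: "r $ (q * p + l) = - (u $ 0 * w $ l)"
    unfolding r_eq by (subst fps_sub_nth) (simp add: fps_X_power_mult_nth t0)

  define P where "P = (\<Prod>i<p - 1. of_nat (q * p + l + i * q) :: 'a)"
  have "of_nat (q * p + l + i * q) \<noteq> (0::'a)" if "i < p - 1" for i
  proof
    assume "of_nat (q * p + l + i * q) = (0::'a)"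
    moreover have "of_nat (q * p + l + i * q) = (of_nat (l * Suc i) :: 'a)"
      by (simp add: p0 ql algebra_simps)
    ultimately have "p dvd l * Suc i"
      using p(2) by (metis of_nat_eq_0_iff_char_dvd)
    then have "p dvd l \<or> p dvd Suc i" by (rule prime_dvd_multD[OF p(1)])
    then show False using l that by (auto dest!: dvd_imp_le)
  qed
  then have P0: "P \<noteq> 0" by (simp add: P_def)

  define G where "G = (fps_diff_op f ^^ p) \<psi>"
  have "G = (fps_diff_op f ^^ (p - 1)) (fps_diff_op f \<psi>)"
    using p2 funpow_Suc_right[of "p - 1" "fps_diff_op f"] by (simp add: G_def)
  also have "fps_diff_op f \<psi> = fps_X ^ (q * p) + r" by (simp add: r_def)
  finally have G_eq: "G = (fps_diff_op f ^^ (p - 1)) (fps_X ^ (q * p)) + (fps_diff_op f ^^ (p - 1)) r"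
    by (simp add: funpow_fps_diff_op_add)
  (* The derivative of X^(qp) is zero, so the first application of \<Delta> gains 2q instead of q.
     This puts the contribution of X^(qp) beyond order N. *)
  have deriv_0: "fps_deriv (fps_X ^ (q * p)) = (0 :: 'a fps)"
    by (rule fps_ext) (auto simp: p0 simp del: of_nat_Suc)
  have "fps_X ^ (q * p + 2 * q) dvd fps_diff_op f (fps_X ^ (q * p))"
    using Taylor_remainder[OF h_dvd, of "q * p" "fps_X ^ (q * p)"] deriv_0
    by (simp add: fps_diff_op_def fh)
  from funpow_fps_diff_op_leading[OF f _ this, of "p - 2"] l
  have "fps_X ^ (q * p + 2 * q + (p - 2) * q) dvd (fps_diff_op f ^^ Suc (p - 2)) (fps_X ^ (q * p))"
    unfolding funpow_Suc_right by simp
  moreover have "Suc (p - 2) = p - 1" using p2 by simp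
  moreover have "q * p + 2 * q + (p - 2) * q \<ge> Suc N"
  proof -
    have "(p - 1) * q = (p - 2) * q + q"
      using \<open>Suc (p - 2) = p - 1\<close> by (metis mult_Suc add.commute)
    then show ?thesis using l by (simp add: N_def)
  qed
  ultimately have mono: "fps_X ^ Suc N dvd (fps_diff_op f ^^ (p - 1)) (fps_X ^ (q * p))"
    by (metis fps_X_power_dvd_mono)
  (* The exponents met on the way are congruent to l, 2l, ..., (p - 1)l modulo p, hence the
     product P of leading factors is nonzero: the coefficient of r at qp + l survives. *)
  have rest: "fps_X ^ N dvd (fps_diff_op f ^^ (p - 1)) r"
    "((fps_diff_op f ^^ (p - 1)) r) $ N = - P * (u $ 0) ^ (p - 1) * u $ 0 * w $ l" 
    using funpow_fps_diff_op_leading[OF f _ r_dvd, of "p - 1"] l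
    by (simp_all add: N_def P_def r_nth mult.assoc)

  define g where "g = fps_iterate p f"
  have G_comp: "G = (\<psi> oo g) - \<psi>"
    unfolding G_def g_def by (rule fps_diff_op_power_CHAR[OF f0 p])
  (* The a priori bound on the order of g - X makes the second-order error E1 invisible at N. *)
  have g_dvd: "fps_X ^ Suc (q * p) dvd g - fps_X"
    unfolding g_def by (rule fps_iterate_CHAR_order[OF p]) (use l f in auto)
  define E1 where "E1 = (\<psi> oo (fps_X + (g - fps_X))) - \<psi> - (g - fps_X) * fps_deriv \<psi>"
  have "fps_X ^ (m + 2 * (q * p)) dvd E1"
    unfolding E1_def by (rule Taylor_remainder[OF g_dvd \<psi>_dvd])
  moreover have "Suc N \<le> m + 2 * (q * p)"
    using l mq by (simp add: N_def m_def mult.commute)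
  ultimately have E1: "fps_X ^ Suc N dvd E1" by (rule fps_X_power_dvd_mono)
  have key: "fps_X ^ (m - 1) * ((g - fps_X) * y) = G - E1"
    unfolding E1_def G_comp deriv_\<psi> by (simp add: ac_simps)
  have N: "N = (m - 1) + Suc (q * p + l)" using m0 by (simp add: N_def m_def mult.commute)
  have "fps_X ^ N dvd G - E1"
    unfolding G_eq using fps_X_power_dvd_mono[OF mono, of N] fps_X_power_dvd_mono[OF E1, of N] rest(1)
    by (intro dvd_diff dvd_add) auto
  then have "fps_X ^ Suc (q * p + l) dvd (g - fps_X) * y"
    unfolding key[symmetric] N power_add by (subst (asm) dvd_mult_cancel_left) simp
  then have "fps_X ^ Suc (q * p + l) dvd (g - fps_X) * y * inverse y" by (rule dvd_mult2)
  moreover have "y * inverse y = 1" using y0 w0 by (intro inverse_mult_eq_1') simp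
  ultimately have "fps_X ^ Suc (q * p + l) dvd g - fps_X" by (simp add: mult.assoc)
  then obtain v where v: "g - fps_X = fps_X ^ Suc (q * p + l) * v" by (auto simp: dvd_def)
  have "fps_X ^ N * (v * y) = G - E1"
    unfolding key[symmetric] v N power_add by (simp only: ac_simps)
  then have "(fps_X ^ N * (v * y)) $ N = G $ N - E1 $ N" by simp
  moreover have "E1 $ N = 0" "((fps_diff_op f ^^ (p - 1)) (fps_X ^ (q * p))) $ N = 0"
    using E1 mono unfolding fps_X_power_dvd_iff by blast+
  ultimately have "v $ 0 * w $ 0 = - P * (u $ 0) ^ (p - 1) * u $ 0 * w $ l"
    using rest(2) unfolding G_eq by (simp add: fps_X_power_mult_nth y0)
  then have "v $ 0 = 0 \<longleftrightarrow> w $ l = 0" using P0 u0 w0 by auto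
  moreover have "g = fps_X + fps_X ^ Suc (q * p + l) * v"
    using v by (metis add.commute diff_add_cancel)
  ultimately show ?thesis unfolding g_def w_def by blast
qed

section \<open>Commuting power series\<close>

text \<open>
  With \<open>h = f - X\<close> and \<open>k = g - X\<close>, commutation says \<open>h \<circ> g - h = k \<circ> f - k\<close>; to first order
  this is \<open>k h' = h k'\<close>. After removing powers of \<open>X\<close>, for which the congruence between \<open>q\<close> and \<open>r\<close>
  is needed, the derivative of \<open>v/u\<close> vanishes to order \<open>q - 1\<close>. Hence \<open>v/u\<close> is constant
  up to order \<open>l\<close>.
\<close>
lemma commuting_fps_inverse_nth:
  fixes u v :: "'a::field fps"
  assumes f: "f = fps_X + fps_X ^ Suc q * u" and g: "g = fps_X + fps_X ^ Suc r * v"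
    and commute: "f oo g = g oo f"
    and u0: "u $ 0 \<noteq> 0" and v0: "v $ 0 \<noteq> 0"
    and qr: "q \<le> r" "of_nat q = (of_nat r :: 'a)"
    and l: "l < q" "\<And>k. 0 < k \<Longrightarrow> k \<le> l \<Longrightarrow> of_nat k \<noteq> (0::'a)"
  shows "inverse u $ l = v $ 0 / u $ 0 * inverse v $ l"
proof -
  define h where "h = fps_X ^ Suc q * u"
  define k where "k = fps_X ^ Suc r * v"
  have fh: "f = fps_X + h" and gk: "g = fps_X + k" by (simp_all add: f g h_def k_def)
  have h_dvd: "fps_X ^ Suc q dvd h" and k_dvd: "fps_X ^ Suc r dvd k"
    by (simp_all add: h_def k_def)
  have "f oo g = g + (h oo g)" "g oo f = f + (k oo f)"
    using f g by (simp_all add: fh gk fps_compose_add_distrib h_def k_def)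
  then have hk: "(h oo g) - h = (k oo f) - k"
    using commute by (simp add: fh gk algebra_simps)
  have "fps_X ^ (Suc q + 2 * r) dvd (h oo g) - h - k * fps_deriv h"
    unfolding gk by (rule Taylor_remainder[OF k_dvd h_dvd])
  then have 1: "fps_X ^ (Suc r + 2 * q) dvd (h oo g) - h - k * fps_deriv h"
    by (rule fps_X_power_dvd_mono) (use qr in simp)
  have 2: "fps_X ^ (Suc r + 2 * q) dvd (k oo f) - k - h * fps_deriv k"
    unfolding fh by (rule Taylor_remainder[OF h_dvd k_dvd])
  have "fps_X ^ (Suc r + 2 * q) dvd k * fps_deriv h - h * fps_deriv k"
    using dvd_diff[OF 2 1] unfolding hk by simp
  then have "fps_X * fps_X ^ (Suc r + 2 * q) dvd fps_X * (k * fps_deriv h - h * fps_deriv k)"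
    by (rule mult_dvd_mono[OF dvd_refl])
  also have "fps_X * (k * fps_deriv h - h * fps_deriv k)
      = k * (fps_X * fps_deriv h) - h * (fps_X * fps_deriv k)"
    by (simp add: algebra_simps)
  also have "fps_X * fps_deriv h = of_nat (Suc q) * h + fps_X ^ Suc q * (fps_X * fps_deriv u)"
    using fps_X_mult_deriv_X_power[of "Suc q", where ?'a = 'a]
    unfolding h_def fps_deriv_mult distrib_left mult.assoc[symmetric] by (simp only: ac_simps)
  also have "fps_X * fps_deriv k = of_nat (Suc r) * k + fps_X ^ Suc r * (fps_X * fps_deriv v)"
    using fps_X_mult_deriv_X_power[of "Suc r", where ?'a = 'a]
    unfolding k_def fps_deriv_mult distrib_left mult.assoc[symmetric] by (simp only: ac_simps)
  also have "of_nat (Suc r) = (of_nat (Suc q) :: 'a fps)"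
    using qr(2) by (simp add: fps_of_nat[symmetric])
  also have "k * (of_nat (Suc q) * h + fps_X ^ Suc q * (fps_X * fps_deriv u))
       - h * (of_nat (Suc q) * k + fps_X ^ Suc r * (fps_X * fps_deriv v))
     = fps_X * fps_X ^ (Suc q + Suc r) * (v * fps_deriv u - u * fps_deriv v)"
    unfolding h_def k_def power_add by (simp add: algebra_simps del: of_nat_Suc)
  also have "fps_X * fps_X ^ (Suc r + 2 * q)
      = fps_X * fps_X ^ (Suc q + Suc r) * (fps_X ^ (q - 1) :: 'a fps)"
    using l(1) unfolding power_Suc[symmetric] power_add[symmetric]
    by (intro arg_cong[where f = "power fps_X"]) simp
  finally have wronskian: "fps_X ^ (q - 1) dvd v * fps_deriv u - u * fps_deriv v"
    by (subst (asm) dvd_mult_cancel_left) simp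
  define c where "c = v * inverse u"
  have uu: "u * inverse u = 1" and vv: "v * inverse v = 1"
    using u0 v0 by (simp_all add: inverse_mult_eq_1')
  have cu: "c * u = v" using uu by (simp add: c_def mult.assoc mult.commute[of _ u])
  (* Quotient rule for c = v/u, with the denominator cleared. *)
  have "fps_deriv c * u ^ 2 = u * (fps_deriv (c * u)) - (c * u) * fps_deriv u"
    by (simp add: algebra_simps power2_eq_square)
  then have "fps_X ^ (q - 1) dvd fps_deriv c * u ^ 2"
    unfolding cu using wronskian by (simp add: dvd_diff_commute)
  then have "fps_X ^ (q - 1) dvd fps_deriv c * u ^ 2 * inverse u ^ 2" by (rule dvd_mult2)
  also have "fps_deriv c * u ^ 2 * inverse u ^ 2 = fps_deriv c"
    unfolding mult.assoc power_mult_distrib[symmetric] uu by simp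
  finally have c': "fps_deriv c $ i = 0" if "i < q - 1" for i
    using that unfolding fps_X_power_dvd_iff by blast
  have c0: "c $ i = 0" if "0 < i" "i \<le> l" for i
    using c'[of "i - 1"] l(2)[OF that] that l(1) by simp
  have "inverse u = c * inverse v"
    using vv by (simp add: c_def mult.assoc mult.commute[of "inverse u"])
  then have "inverse u $ l = (\<Sum>i=0..l. c $ i * inverse v $ (l - i))"
    by (simp add: fps_mult_nth)
  also have "\<dots> = (\<Sum>i\<in>{0}. c $ i * inverse v $ (l - i))"
    by (rule sum.mono_neutral_right) (auto simp: c0)
  finally show ?thesis by (simp add: c_def divide_inverse)
qed

section \<open>All iterates\<close>

text \<open>
  The pair (order, index) reproduces itself: the \<open>n\<close>-th order is again congruent to \<open>l\<close> modulo
  \<open>p\<close> and at least \<open>q\<close>, and the index stays nonzero since each series commutes with its \<open>p\<close>-th iterate. The orders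
  satisfy \<open>Q\<^sub>n\<^sub>+\<^sub>1 = p Q\<^sub>n + l\<close>.
\<close>
lemma fps_iterate_CHAR_power_leading:
  fixes u :: "'a::field fps"
  assumes p: "prime p" "CHAR('a) = p"
    and l: "0 < l" "l < p" "l < q" and ql: "of_nat q = (of_nat l :: 'a)"
    and f: "f = fps_X + fps_X ^ Suc q * u" and u0: "u $ 0 \<noteq> 0"
    and index: "inverse u $ l \<noteq> 0"
  shows "\<exists>v. fps_iterate (p ^ n) f = fps_X + fps_X ^ Suc (l * (\<Sum>k<n. p ^ k) + q * p ^ n) * v
            \<and> v $ 0 \<noteq> 0 \<and> inverse v $ l \<noteq> 0"
proof (induction n)
  case 0
  show ?case using f u0 index by auto
next
  case (Suc n)
  define Q where "Q = l * (\<Sum>k<n. p ^ k) + q * p ^ n"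
  have p1: "p \<ge> 1" using l by simp
  have p0: "of_nat p = (0::'a)" using p(2) by (metis of_nat_CHAR)
  have f0: "f $ 0 = 0" by (simp add: f)
  define g where "g = fps_iterate (p ^ n) f"
  obtain v where g: "g = fps_X + fps_X ^ Suc Q * v" and v0: "v $ 0 \<noteq> 0"
    and v_index: "inverse v $ l \<noteq> 0"
    using Suc.IH unfolding Q_def g_def by blast
  have g0: "g $ 0 = 0" by (simp add: g)
  have Q_Suc: "l * (\<Sum>k<Suc n. p ^ k) + q * p ^ Suc n = Q * p + l"
    unfolding sum.lessThan_Suc_shift by (simp add: Q_def sum_distrib_left sum_distrib_right algebra_simps)
  have "q * 1 \<le> q * p ^ n" using p1 by (intro mult_le_mono2) simp
  then have qQ: "q \<le> Q" by (simp only: Q_def mult_1_right trans_le_add2)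
  then have lQ: "l < Q" using l by simp
  have Ql: "of_nat Q = (of_nat l :: 'a)"
  proof (cases n)
    case 0
    then show ?thesis by (simp add: Q_def ql)
  next
    case (Suc j)
    have "(\<Sum>k<Suc j. (of_nat p :: 'a) ^ k) = 1"
      unfolding sum.lessThan_Suc_shift p0 by simp
    then show ?thesis by (simp add: Q_def Suc p0 del: sum.lessThan_Suc)
  qed
  obtain v' where v': "fps_iterate p g = fps_X + fps_X ^ Suc (Q * p + l) * v'"
    and v'0: "v' $ 0 = 0 \<longleftrightarrow> inverse v $ l = 0"
    using fps_iterate_CHAR_leading[OF p l(1,2) lQ Ql g v0] by blast
  have "inverse v $ l = v' $ 0 / v $ 0 * inverse v' $ l"
  proof (rule commuting_fps_inverse_nth[OF g v' fps_iterate_commute[OF g0] v0 _ _ _ lQ])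
    show "v' $ 0 \<noteq> 0" using v'0 v_index by simp
    show "Q \<le> Q * p + l" using p1 by (cases p) auto
    show "of_nat Q = (of_nat (Q * p + l) :: 'a)" by (simp add: Ql p0)
    fix k assume "0 < k" "k \<le> l"
    then show "of_nat k \<noteq> (0::'a)"
      using l p(2) by (auto simp: of_nat_eq_0_iff_char_dvd dest: dvd_imp_le)
  qed
  then have "inverse v' $ l \<noteq> 0" using v_index by auto
  moreover have "fps_iterate (p ^ Suc n) f = fps_iterate p g"
    unfolding g_def power_Suc by (rule fps_iterate_mult[OF f0])
  ultimately show ?case unfolding Q_Suc using v' v'0 v_index by auto
qed

lemma fps_iterate_CHAR_power_order:
  fixes f :: "'a::field fps"
  assumes p: "prime p" "CHAR('a) = p" and s: "s > 0"
    and f: "f $ 0 = 0" "fps_X ^ Suc s dvd fps_iterate p f - fps_X"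
  shows "fps_X ^ Suc (p ^ n * s) dvd fps_iterate (p ^ Suc n) f - fps_X"
proof (induction n)
  case 0
  show ?case using f by simp
next
  case (Suc n)
  have "fps_X ^ Suc (p ^ n * s * p) dvd fps_iterate p (fps_iterate (p ^ Suc n) f) - fps_X"
    using s p(1) Suc.IH prime_gt_0_nat by (intro fps_iterate_CHAR_order[OF p]) auto
  then show ?case
    using fps_iterate_mult[OF f(1), of p "p ^ Suc n"] by (simp add: ac_simps)
qed

text \<open>
  In base \<open>p\<close>, the left side is the number whose \<open>n\<close> digits are all equal to \<open>l\<close>.
\<close>
lemma mult_geometric_sum_less:
  fixes l p :: nat
  assumes "l < p"
  shows "l * (\<Sum>k<n. p ^ k) < p ^ n"
proof (induction n)
  case (Suc n)
  have "l * (\<Sum>k<Suc n. p ^ k) < p ^ n + l * p ^ n"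
    using Suc by (simp add: distrib_left)
  also have "\<dots> = Suc l * p ^ n" by simp
  also have "\<dots> \<le> p * p ^ n" using assms by (intro mult_le_mono1) simp
  finally show ?case by simp
qed simp

section \<open>Ramification numbers and the index\<close>

lemma fps_mult_eq:
  fixes u :: "'a::field fps"
  assumes "u $ 0 \<noteq> 0"
  shows "fps_mult (fps_X + fps_X ^ s * u) = enat s"
proof -
  have "subdegree (fps_X ^ s * u) = s"
    using assms by (intro subdegreeI) (simp_all add: fps_X_power_mult_nth)
  moreover have "u \<noteq> 0" using assms by auto
  ultimately show ?thesis by (simp add: fps_mult_def)
qed

lemma fps_mult_ge:
  fixes f :: "'a::field fps"
  assumes "fps_X ^ s dvd f - fps_X"
  shows "fps_mult f \<ge> enat s"
proof (cases "f = fps_X")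
  case False
  then have "s \<le> subdegree (f - fps_X)"
    using assms by (intro subdegree_geI) (simp_all add: fps_X_power_dvd_iff)
  then show ?thesis using False by (simp add: fps_mult_def)
qed (simp add: fps_mult_def)

text \<open>
  The quotient defining the index is \<open>- X\<^sup>-\<^sup>l\<^sup>-\<^sup>1 / u\<close>, so the residue reads off the
  coefficient of \<open>X\<^sup>l\<close> in \<open>1/u\<close>. The sign comes from \<open>X - f\<close> in the denominator.
\<close>
lemma second_residue_index_eq:
  fixes u :: "'a::field fps"
  assumes u0: "u $ 0 \<noteq> 0" and l: "l \<le> q"
  shows "second_residue_index q l (fps_X + fps_X ^ Suc q * u) = - inverse u $ l"
proof -
  let ?U = "fps_to_fls u" and ?W = "fps_to_fls (inverse u)"
  define Z where "Z = fls_X ^ (q - l) / (fls_X - fps_to_fls (fps_X + fps_X ^ Suc q * u))"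
  have UW: "?U * ?W = 1"
    using u0 by (simp add: fls_times_fps_to_fls[symmetric] inverse_mult_eq_1')
  then have U0: "?U \<noteq> 0" by auto
  have "fls_X - fps_to_fls (fps_X + fps_X ^ Suc q * u) = - (fls_X ^ Suc q * ?U)"
    by (simp add: fls_times_fps_to_fls fps_to_fls_power del: power_Suc)
  also have "fls_X ^ Suc q = (fls_X ^ (q - l) * fls_X ^ Suc l :: 'a fls)"
    using l by (simp add: power_add[symmetric] del: power_Suc)
  finally have "fls_X ^ Suc l * Z = - inverse ?U"
    using U0 by (simp add: Z_def field_simps del: power_Suc)
  also have "inverse ?U = ?W" using UW by (rule inverse_unique)
  finally have "fls_nth (fls_X ^ Suc l * Z) (int l) = - inverse u $ l" by simp
  then have "fls_nth Z (-1) = - inverse u $ l"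
    by (simp add: fls_X_power_times_conv_shift del: power_Suc)
  then show ?thesis by (simp add: second_residue_index_def Z_def)
qed

theorem theorem1:
  fixes p q l n :: nat and f :: "'a::field fps"
  assumes "prime p" and "CHAR('a) = p"
    and "q > p" and "\<not> p dvd q"
    and "l = (LEAST k. (of_nat q :: 'a) = of_nat k)"
    and "fps_nth f 0 = 0" and "fps_mult f = enat (q + 1)"
    and "n \<ge> 1"
  shows "lower_ramification_number p n f = enat (l * (\<Sum>k<n. p ^ k) + q * p ^ n)
           \<longleftrightarrow> second_residue_index q l f \<noteq> 0"
proof -
  note p = assms(1,2)
  have ql: "of_nat q = (of_nat l :: 'a)"
    unfolding assms(5) by (rule LeastI[of _ q]) simp
  have "of_nat q = (of_nat (p * (q div p) + q mod p) :: 'a)" by simp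
  also have "\<dots> = of_nat (q mod p)"
    unfolding of_nat_add of_nat_mult using p(2) by (metis add_0 mult_zero_left of_nat_CHAR)
  finally have "l \<le> q mod p" unfolding assms(5) by (rule Least_le)
  then have lp: "l < p" using p(1) prime_gt_0_nat by (meson mod_less_divisor le_less_trans)
  then have lq: "l < q" using assms(3) by simp
  have "(of_nat q :: 'a) \<noteq> 0" using assms(4) p(2) by (simp add: of_nat_eq_0_iff_char_dvd)
  then have l0: "0 < l" using ql by (cases l) auto
  have fX: "f \<noteq> fps_X" and sub: "subdegree (f - fps_X) = Suc q"
    using assms(7) by (auto simp: fps_mult_def split: if_splits)
  define u where "u = fps_shift (Suc q) (f - fps_X)"
  have u0: "u $ 0 \<noteq> 0"
    using nth_subdegree_nonzero[of "f - fps_X"] fX unfolding sub u_def by simp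
  have "f - fps_X = fps_X ^ Suc q * u"
    using subdegree_decompose[of "f - fps_X"] unfolding sub u_def by (simp only: mult.commute)
  then have f: "f = fps_X + fps_X ^ Suc q * u" by (metis add.commute diff_add_cancel)
  have index: "second_residue_index q l f = - inverse u $ l"
    unfolding f by (rule second_residue_index_eq[OF u0]) (use lq in simp)
  let ?r = "l * (\<Sum>k<n. p ^ k) + q * p ^ n"
  show ?thesis
  proof (cases "inverse u $ l = 0")
    case False
    obtain v where "fps_iterate (p ^ n) f = fps_X + fps_X ^ Suc ?r * v" "v $ 0 \<noteq> 0"
      using fps_iterate_CHAR_power_leading[OF p l0 lp lq ql f u0 False] by blast
    then have "lower_ramification_number p n f = enat ?r"
      unfolding lower_ramification_number_def
      by (simp add: fps_mult_eq one_enat_def del: power_Suc)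
    then show ?thesis using False index by simp
  next
    case True
    obtain v where v: "fps_iterate p f = fps_X + fps_X ^ Suc (q * p + l) * v" "v $ 0 = 0"
      using fps_iterate_CHAR_leading[OF p l0 lp lq ql f u0] True by blast
    let ?s = "Suc (q * p + l)"
    (* One order more than in the nonzero case, and this excess is multiplied by p at every step,
       faster than the digits l of the expected value accumulate. *)
    have "fps_X dvd v" using v(2) fps_X_power_dvd_iff[of 1 v] by simp
    then have "fps_X ^ Suc ?s dvd fps_iterate p f - fps_X"
      unfolding v(1) by (simp add: mult.commute mult_dvd_mono)
    from fps_iterate_CHAR_power_order[OF p _ assms(6) this, of "n - 1"] assms(8)
    have "fps_X ^ Suc (p ^ (n - 1) * ?s) dvd fps_iterate (p ^ n) f - fps_X" by simp
    then have "fps_mult (fps_iterate (p ^ n) f) \<ge> enat (Suc (p ^ (n - 1) * ?s))"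
      by (rule fps_mult_ge)
    moreover have "?r < p ^ (n - 1) * ?s"
    proof -
      obtain j where n: "n = Suc j" using assms(8) by (cases n) auto
      show ?thesis using mult_geometric_sum_less[OF lp, of j] by (simp add: n algebra_simps)
    qed
    ultimately have "lower_ramification_number p n f \<noteq> enat ?r"
      unfolding lower_ramification_number_def
      by (cases "fps_mult (fps_iterate (p ^ n) f)") (auto simp: one_enat_def)
    then show ?thesis using True index by simp
  qed
qed

end
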